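(* For every positive integer $\alpha$, the algorithm $\alpha$-Balanced is an optimal strategy for Scheduler in the $\alpha$-lazy matching game: for every $n$, the worst-case size of the matching constructed by $\alpha$-Balanced over all $\alpha$-lazy matching games of size $n$ equals $\mathrm{Val}_\alpha(n)$, the maximum of this worst-case value over all Scheduler strategies.
   Context: The $\alpha$-lazy matching game ($\alpha$ a positive integer) is played by Scheduler and Builder on a finite set $D$ known in advance, for finitely many rounds. In each round: (1) Builder presents a new vertex $u$ together with its neighbourhood $N(u)\subseteq D$; (2) Scheduler chooses a set $m(u)\subseteq N(u)$ with $|m(u)|\le\alpha$, and then replaces $m(x)$ by $m(x)\setminus m(u)$ for every vertex $x$ presented earlier. Let $U$ be the set of all presented vertices and $G=(U,D,E)$ the bipartite graph with $(u,d)\in E$ iff $d\in N(u)$. The size $n$ of the game is the maximum size of a matching in $G$. The size of the matching constructed by Scheduler is the number of $u\in U$ with $m(u)\neq\emptyset$ at the end of the game. For a Scheduler algorithm $\mathcal A$, $\mathrm{Val}_{\mathcal A}(n)$ is the minimum, over all games of size $n$, of the size of the matching constructed by $\mathcal A$; $\mathrm{Val}_\alpha(n)$ is the maximum of $\mathrm{Val}_{\mathcal A}(n)$ over all Scheduler algorithms $\mathcal A$. At any moment, $d\in D$ is available for $u$ if $d\in N(u)$ and $m(x)\neq\{d\}$ for every $x$ presented earlier; $d$ is strongly available for $u$ if it is available for $u$ and belongs to no set $m(x)$; a presented vertex $e$ is ready for $u$ if $m(e)$ contains an element available for $u$. Algorithm $\alpha$-Balanced: when $u$ is presented (with $U$ denoting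 the set of vertices presented so far, including $u$), set $m(u):=\emptyset$; put into $m(u)$ as many strongly available elements for $u$ as possible, but at most $\alpha$; then, while there exists $e\in U$ that is ready for $u$ and satisfies $|m(u)|+2\le |m(e)|$, choose among all such $e$ one with $|m(e)|$ maximal and move one element available for $u$ from $m(e)$ to $m(u)$. *)

theory Defs
  imports Main "HOL-Library.Infinite_Typeclass"
begin

text \<open>
  A (completed) game is a pair \<open>(D, Ns)\<close>: the vertex presented in round \<open>t\<close> (counting from 0) is
  identified with the number \<open>t\<close>, and \<open>Ns ! t\<close> is its neighbourhood. An assignment \<open>m\<close> maps every
  presented vertex to a subset of \<open>D\<close>, and every other number to the empty set.
\<close>

definition games :: "('d set \<times> 'd set list) set" where
  "games = {(D, Ns). finite D \<and> (\<forall>N\<in>set Ns. N \<subseteq> D)}"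

definition edges :: "'d set list \<Rightarrow> (nat \<times> 'd) set" where
  "edges Ns = {(u, d). u < length Ns \<and> d \<in> Ns ! u}"

definition is_matching :: "'d set list \<Rightarrow> (nat \<times> 'd) set \<Rightarrow> bool" where
  "is_matching Ns M \<longleftrightarrow> M \<subseteq> edges Ns \<and> inj_on fst M \<and> inj_on snd M"

definition game_size :: "'d set list \<Rightarrow> nat" where
  "game_size Ns = Max {card M | M. is_matching Ns M}"

text \<open>
  A Scheduler algorithm maps \<open>D\<close> and the neighbourhoods presented so far (the current one last) to
  the set chosen for the current vertex. Algorithms are deterministic, so their own earlier choices
  are determined by these data, and an adaptive Builder achieves no more than a fixed sequence of
  neighbourhoods does.
\<close>

type_synonym 'd algorithm = "'d set \<Rightarrow> 'd set list \<Rightarrow> 'd set"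

definition scheduler :: "nat \<Rightarrow> 'd algorithm \<Rightarrow> bool" where
  "scheduler \<alpha> A \<longleftrightarrow>
     (\<forall>(D, Ns)\<in>games. Ns \<noteq> [] \<longrightarrow> A D Ns \<subseteq> last Ns \<and> card (A D Ns) \<le> \<alpha>)"

text \<open>The assignment after the first \<open>t\<close> rounds:\<close>

fun assignment :: "'d algorithm \<Rightarrow> 'd set \<Rightarrow> 'd set list \<Rightarrow> nat \<Rightarrow> nat \<Rightarrow> 'd set" where
  "assignment A D Ns 0 = (\<lambda>x. {})"
| "assignment A D Ns (Suc t) =
     (let mu = A D (take (Suc t) Ns)
      in (\<lambda>x. if x = t then mu else assignment A D Ns t x - mu))"

definition matching_size :: "'d algorithm \<Rightarrow> 'd set \<Rightarrow> 'd set list \<Rightarrow> nat" where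
  "matching_size A D Ns =
     card {u. u < length Ns \<and> assignment A D Ns (length Ns) u \<noteq> {}}"

text \<open>
  For a Scheduler algorithm, the constructed matching is a matching of the presented graph, so the
  \<open>Min\<close> and \<open>Max\<close> below range over subsets of \<open>{0..n}\<close>. They are nonempty if \<open>'d\<close> is infinite, since
  then games of every size exist.
\<close>

definition val_alg :: "'d algorithm \<Rightarrow> nat \<Rightarrow> nat" where
  "val_alg A n = Min {matching_size A D Ns | D Ns. (D, Ns) \<in> games \<and> game_size Ns = n}"

definition val :: "'d itself \<Rightarrow> nat \<Rightarrow> nat \<Rightarrow> nat" where
  "val _ \<alpha> n = Max {val_alg A n | A :: 'd algorithm. scheduler \<alpha> A}"

text \<open>
  In the following, \<open>u\<close> is the current vertex (so \<open>x < u\<close> says that \<open>x\<close> was presented earlier), \<open>N\<close>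
  its neighbourhood, and \<open>m\<close> the assignment at the moment considered.
\<close>

definition available :: "(nat \<Rightarrow> 'd set) \<Rightarrow> nat \<Rightarrow> 'd set \<Rightarrow> 'd \<Rightarrow> bool" where
  "available m u N d \<longleftrightarrow> d \<in> N \<and> (\<forall>x<u. m x \<noteq> {d})"

definition strongly_available :: "(nat \<Rightarrow> 'd set) \<Rightarrow> nat \<Rightarrow> 'd set \<Rightarrow> 'd \<Rightarrow> bool" where
  "strongly_available m u N d \<longleftrightarrow> available m u N d \<and> (\<forall>x\<le>u. d \<notin> m x)"

definition ready :: "(nat \<Rightarrow> 'd set) \<Rightarrow> nat \<Rightarrow> 'd set \<Rightarrow> nat \<Rightarrow> bool" where
  "ready m u N e \<longleftrightarrow> e \<le> u \<and> (\<exists>d\<in>m e. available m u N d)"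

definition donor :: "(nat \<Rightarrow> 'd set) \<Rightarrow> nat \<Rightarrow> 'd set \<Rightarrow> nat \<Rightarrow> bool" where
  "donor m u N e \<longleftrightarrow> ready m u N e \<and> card (m u) + 2 \<le> card (m e)"

definition move :: "nat \<Rightarrow> 'd set \<Rightarrow> (nat \<Rightarrow> 'd set) \<Rightarrow> (nat \<Rightarrow> 'd set) \<Rightarrow> bool" where
  "move u N m m' \<longleftrightarrow>
     (\<exists>e d. donor m u N e \<and> (\<forall>e'. donor m u N e' \<longrightarrow> card (m e') \<le> card (m e)) \<and>
            d \<in> m e \<and> available m u N d \<and>
            m' = m(e := m e - {d}, u := insert d (m u)))"

definition balanced_round ::
    "nat \<Rightarrow> nat \<Rightarrow> 'd set \<Rightarrow> (nat \<Rightarrow> 'd set) \<Rightarrow> (nat \<Rightarrow> 'd set) \<Rightarrow> bool" where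
  "balanced_round \<alpha> u N m m' \<longleftrightarrow>
     (let m0 = m(u := {}); SA = {d. strongly_available m0 u N d}
      in \<exists>S. S \<subseteq> SA \<and> card S = min \<alpha> (card SA) \<and>
             (move u N)\<^sup>*\<^sup>* (m0(u := S)) m' \<and> (\<nexists>e. donor m' u N e))"

text \<open>
  \<open>\<alpha>\<close>-Balanced leaves open which strongly available elements, which \<open>e\<close> of maximal \<open>|m(e)|\<close>, and which
  element of \<open>m(e)\<close> are taken. The predicate holds for the algorithms that resolve these choices in
  any way whatsoever, possibly depending on the history.
\<close>

definition balanced :: "nat \<Rightarrow> 'd algorithm \<Rightarrow> bool" where
  "balanced \<alpha> A \<longleftrightarrow>
     (\<forall>(D, Ns)\<in>games. \<forall>t<length Ns.
        balanced_round \<alpha> t (Ns ! t) (assignment A D Ns t) (assignment A D Ns (Suc t)))"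

end

theory Submission
  imports Defs "HOL-Library.Disjoint_Sets"
begin

text \<open>
  Both directions go through the sums \<open>F\<^sub>c = \<Sum>\<^sub>x min |m(x)| c\<close>. The number of elements lying in sets of
  size at most \<open>c\<close> is \<open>(c + 1) F\<^sub>c - c F\<^sub>c\<^sub>+\<^sub>1\<close>.

  If \<open>\<alpha>\<close>-Balanced gives at least \<open>c\<close> elements to \<open>u\<close>, then every set it has shrunk still has at least
  \<open>c\<close> elements, so \<open>F\<^sub>c\<close> grows by \<open>c\<close>; otherwise \<open>F\<^sub>c\<close> does not decrease and, at the end of the
  game, all of \<open>N(u)\<close> lies in sets of size at most \<open>c\<close>. With \<open>Y\<^sub>c\<close> the number of rounds of the first
  kind this gives \<open>c Y\<^sub>c \<le> F\<^sub>c\<close> and, by covering a maximum matching,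
  \<open>n \<le> (c + 1) F\<^sub>c - c F\<^sub>c\<^sub>+\<^sub>1 + Y\<^sub>c\<close>, while \<open>F\<^sub>1\<close> is the size of the constructed matching.

  Conversely, every solution \<open>(F, Y)\<close> of these inequalities lets Builder hold an arbitrary Scheduler
  down to \<open>F\<^sub>1\<close>. With \<open>r\<close> rounds left, Builder presents some \<open>r\<close>-element set; choosing distinct
  representatives from the last round backwards shows that the game has size \<open>n\<close> whatever these sets
  are. Keeping \<open>F\<close> and lowering each positive \<open>Y\<^sub>c\<close> by one preserves the inequalities, because a round
  increases the current \<open>\<Sum>\<^sub>x min |m(x)| c\<close> by at most \<open>c\<close>. Where \<open>Y\<^sub>c = 0\<close> this sum must stay below
  \<open>F\<^sub>c\<close>, which Builder achieves by withholding the largest sets.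
\<close>

section \<open>Builder's reserve of withheld elements\<close>

text \<open>Going down from \<open>c + 1\<close> to \<open>c\<close>, the division by
  \<open>c + 1\<close> loses less than one against \<open>r + min h c\<close>, so integrality
  recovers the bound. In use, \<open>h\<close> is the part withheld from a single set, and only the
  bound at \<open>\<alpha>\<close> has to be found.\<close>

lemma descend:
  fixes F :: "nat \<Rightarrow> nat"
  assumes step: "\<And>c. l \<le> c \<Longrightarrow> c < \<alpha> \<Longrightarrow> r + c * F (Suc c) \<le> Suc c * F c"
    and top: "r + min h \<alpha> \<le> F \<alpha>" and c: "l \<le> c" "c \<le> \<alpha>"
  shows "r + min h c \<le> F c"
  using c(2,1)
proof (induction rule: inc_induct)
  case base
  then show ?case using top by simp
next
  case (step c)
  have "Suc c * r + c * min h (Suc c) \<le> r + c * F (Suc c)"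
    using mult_le_mono2[OF step.IH, of c] step.prems by (simp add: algebra_simps)
  also have "\<dots> \<le> Suc c * F c" using assms(1) step by simp
  finally have *: "Suc c * r + c * min h (Suc c) \<le> Suc c * F c" .
  show ?case
  proof (rule ccontr)
    assume "\<not> ?thesis"
    then have "F c + 1 \<le> r + min h c" by simp
    then have "Suc c * F c + Suc c \<le> Suc c * r + Suc c * min h c"
      using mult_le_mono2[of "F c + 1" "r + min h c" "Suc c"] by (simp add: algebra_simps)
    moreover have "Suc c * min h c < c * min h (Suc c) + Suc c"
      by (cases "h \<le> c") (auto simp: min_def not_less_eq_eq)
    ultimately show False using * by linarith
  qed
qed

lemma finite_has_largest:
  fixes f :: "'a \<Rightarrow> nat"
  assumes "finite X" "X \<noteq> {}"
  shows "\<exists>x\<in>X. \<forall>y\<in>X. f y \<le> f x"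
proof -
  have "Max (f ` X) \<in> f ` X" using assms by (intro Max_in) auto
  then obtain x where "x \<in> X" "f x = Max (f ` X)" by auto
  then show ?thesis using assms by (intro bexI[of _ x]) auto
qed

text \<open>
  \<open>X\<close> is what Builder withholds: first the elements in no set, then whole sets in order of decreasing
  size, and part of the last one.
\<close>

lemma exists_reserve:
  fixes m :: "'i \<Rightarrow> 'd set" and F :: "nat \<Rightarrow> nat"
  assumes "finite I" "finite D" "disjoint_family_on m I"
    and "\<And>i. i \<in> I \<Longrightarrow> m i \<subseteq> D" "\<And>i. i \<in> I \<Longrightarrow> card (m i) \<le> \<alpha>"
    and "r \<le> card D"
    and "\<And>c. l \<le> c \<Longrightarrow> c \<le> \<alpha> \<Longrightarrow> (\<Sum>i\<in>I. min (card (m i)) c) \<le> F c"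
    and "\<And>c. l \<le> c \<Longrightarrow> c < \<alpha> \<Longrightarrow> r + c * F (Suc c) \<le> Suc c * F c"
    and "l \<le> \<alpha> \<Longrightarrow> r \<le> F \<alpha>"
  shows "\<exists>X \<subseteq> D. card X = card D - r \<and>
    (\<forall>c. l \<le> c \<longrightarrow> c \<le> \<alpha> \<longrightarrow> r + (\<Sum>i\<in>I. min (card (m i \<inter> X)) c) \<le> F c)"
  using assms
proof (induction "card I" arbitrary: I D F rule: less_induct)
  case less
  let ?A = "\<Union>i\<in>I. m i"
  define f where "f = card (D - ?A)"
  define a where "a = card ?A"
  have fin: "finite (m i)" if "i \<in> I" for i using less.prems(2,4) that finite_subset by blast
  have a_sum: "a = (\<Sum>i\<in>I. card (m i))"
    unfolding a_def using less.prems fin by (intro card_UN_disjoint') auto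
  have AD: "?A \<subseteq> D" using less.prems by auto
  have D: "card D = a + f"
    unfolding a_def f_def using AD less.prems(2)
    by (metis card_Diff_subset card_mono finite_subset le_add_diff_inverse)
  show ?case
  proof (cases "l \<le> \<alpha> \<and> f < card D - r")
    case False
    show ?thesis
    proof (cases "l \<le> \<alpha>")
      case True
      with False have "card D - r \<le> card (D - ?A)" by (simp add: f_def)
      then obtain X where X: "X \<subseteq> D - ?A" "card X = card D - r"
        by (meson obtain_subset_with_card_n)
      have "m i \<inter> X = {}" if "i \<in> I" for i using X that by auto
      then have "(\<Sum>i\<in>I. min (card (m i \<inter> X)) c) = 0" for c by simp
      moreover have "r + min 0 c \<le> F c" if "l \<le> c" "c \<le> \<alpha>" for c
        by (rule descend[of l \<alpha>]) (use less.prems True that in auto)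
      ultimately show ?thesis using X by (intro exI[of _ X]) auto
    next
      case False
      obtain X where "X \<subseteq> D" "card X = card D - r"
        by (meson obtain_subset_with_card_n diff_le_self)
      with False show ?thesis by (intro exI[of _ X]) auto
    qed
  next
    case True
    then have f: "f < card D - r" and l: "l \<le> \<alpha>" by auto
    have "I \<noteq> {}" using f by (auto simp: f_def)
    then obtain j where j: "j \<in> I" and jmax: "\<And>i. i \<in> I \<Longrightarrow> card (m i) \<le> card (m j)"
      using finite_has_largest[OF less.prems(1), of "\<lambda>i. card (m i)"] by blast
    define g where "g = card (m j)"
    have W_large: "(\<Sum>i\<in>I. min (card (m i)) c) = a" if "g \<le> c" for c
      unfolding a_sum using jmax that by (intro sum.cong) (auto simp: g_def min_def dest: le_trans)
    have ga: "g \<le> \<alpha>" using less.prems(5) j by (simp add: g_def)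
    have aF: "a \<le> F c" if "l \<le> c" "g \<le> c" "c \<le> \<alpha>" for c
      using less.prems(7)[of c] W_large that by simp
    show ?thesis
    proof (cases "card D - r - f \<le> g")
      case True
      define h where "h = card D - r - f"
      obtain X0 where X0: "X0 \<subseteq> m j" "card X0 = h"
        using True unfolding h_def g_def by (meson obtain_subset_with_card_n)
      define X where "X = (D - ?A) \<union> X0"
      have finX: "finite X0" "finite (D - ?A)" using X0 fin j less.prems(2) finite_subset by auto
      have "(D - ?A) \<inter> X0 = {}" using X0 j by auto
      then have cX: "card X = card D - r"
        unfolding X_def using finX X0 f by (simp add: card_Un_disjoint h_def f_def)
      have mX: "m i \<inter> X = (if i = j then X0 else {})" if "i \<in> I" for i
        using X0 j that disjoint_family_onD[OF less.prems(3), of i j] by (auto simp: X_def)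
      have "(\<Sum>i\<in>I. min (card (m i \<inter> X)) c) = (\<Sum>i\<in>I. if i = j then min h c else 0)" for c
        using mX X0 by (intro sum.cong) auto
      then have sX: "(\<Sum>i\<in>I. min (card (m i \<inter> X)) c) = min h c" for c
        using j less.prems(1) by simp
      have "r + h = a" using D f less.prems(6) by (simp add: h_def)
      then have top: "r + min h \<alpha> \<le> F \<alpha>" using aF[of \<alpha>] l ga by simp
      have "r + min h c \<le> F c" if "l \<le> c" "c \<le> \<alpha>" for c
        by (rule descend[of l \<alpha>]) (use less.prems top that in auto)
      moreover have "X \<subseteq> D" using X0 AD j by (auto simp: X_def)
      ultimately show ?thesis using cX sX by (intro exI[of _ X]) auto
    next
      case False
      then have rg: "r + g \<le> a" using D f by linarith
      \<comment> \<open>For \<open>c \<le> g\<close> the withheld set \<open>m j\<close> uses up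
        \<open>c\<close> of the bound. Above \<open>g\<close> the cap cuts no set, so the sum over
        the remaining sets is exactly \<open>a - g\<close>. Taking \<open>F c - g\<close> there need
        not preserve the chain of inequalities, whereas for the constant the chain reduces to
        \<open>r \<le> a - g\<close>.\<close>
      define F' where "F' c = (if c \<le> g then F c - c else a - g)" for c
      define I' where "I' = I - {j}"
      define D' where "D' = D - m j"
      have split: "(\<Sum>i\<in>I. \<phi> i) = \<phi> j + (\<Sum>i\<in>I'. \<phi> i)" for \<phi> :: "'i \<Rightarrow> nat"
        unfolding I'_def using j less.prems(1) by (rule sum.remove[rotated])
      have cD': "card D' = card D - g"
        unfolding D'_def g_def using less.prems(4)[OF j] fin[OF j] by (rule card_Diff_subset[rotated])
      \<comment> \<open>The set \<open>m j\<close> alone contributes \<open>c\<close> to the sum, so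
        \<open>F c - c\<close> is not truncated.\<close>
      have cF: "c \<le> F c" if "l \<le> c" "c \<le> g" for c
      proof -
        have "min (card (m j)) c \<le> F c"
          using less.prems(7)[of c] split[of "\<lambda>i. min (card (m i)) c"] that ga by simp
        then show ?thesis using that by (simp add: g_def)
      qed
      have "\<exists>X \<subseteq> D'. card X = card D' - r \<and>
        (\<forall>c. l \<le> c \<longrightarrow> c \<le> \<alpha> \<longrightarrow> r + (\<Sum>i\<in>I'. min (card (m i \<inter> X)) c) \<le> F' c)"
      proof (rule less.hyps)
        show "card I' < card I" unfolding I'_def using less.prems(1) j by (rule card_Diff1_less)
        show "finite I'" "finite D'" using less.prems by (auto simp: I'_def D'_def)
        show "disjoint_family_on m I'"
          using less.prems(3) by (auto simp: I'_def disjoint_family_on_def)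
        show "m i \<subseteq> D'" if "i \<in> I'" for i
          using that less.prems(4)[of i] disjoint_family_onD[OF less.prems(3), of i j] j
          by (auto simp: I'_def D'_def)
        show "card (m i) \<le> \<alpha>" if "i \<in> I'" for i using that less.prems(5) by (simp add: I'_def)
        show "r \<le> card D'" using cD' rg D by simp
        show "(\<Sum>i\<in>I'. min (card (m i)) c) \<le> F' c" if "l \<le> c" "c \<le> \<alpha>" for c
          using less.prems(7)[OF that] split[of "\<lambda>i. min (card (m i)) c"] W_large[of c]
          unfolding F'_def g_def[symmetric] by (cases "c \<le> g") (simp_all add: min_absorb1 min_absorb2)
        show "r + c * F' (Suc c) \<le> Suc c * F' c" if c: "l \<le> c" "c < \<alpha>" for c
        proof -
          consider "c < g" | "c = g" | "g < c" by linarith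
          then show ?thesis
          proof cases
            case 1
            then have "c \<le> F c" "Suc c \<le> F (Suc c)" using cF c by auto
            then obtain p q where "F c = c + p" "F (Suc c) = Suc c + q" by (metis le_Suc_ex)
            then show ?thesis using less.prems(8)[OF c] 1 by (simp add: F'_def algebra_simps)
          next
            case 2
            have "a - g \<le> F g - g" using aF[of g] c 2 by simp
            then have "r + g * (a - g) \<le> F g - g + g * (F g - g)"
              using rg by (intro add_mono mult_le_mono2) auto
            then show ?thesis using 2 by (simp add: F'_def)
          next
            case 3
            then show ?thesis using rg by (simp add: F'_def)
          qed
        qed
        show "r \<le> F' \<alpha>" if "l \<le> \<alpha>"
          using aF[of \<alpha>] that ga rg by (auto simp: F'_def)
      qed
      then obtain X where X: "X \<subseteq> D'" "card X = card D' - r"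
        and XF: "\<And>c. l \<le> c \<Longrightarrow> c \<le> \<alpha> \<Longrightarrow> r + (\<Sum>i\<in>I'. min (card (m i \<inter> X)) c) \<le> F' c"
        by blast
      define Y where "Y = X \<union> m j"
      have finX: "finite X" using X less.prems(2) by (auto simp: D'_def intro: finite_subset)
      have "card Y = card X + g"
        unfolding Y_def g_def using X(1) finX fin[OF j] by (intro card_Un_disjoint) (auto simp: D'_def)
      then have cY: "card Y = card D - r" using X cD' rg D by simp
      have sY: "(\<Sum>i\<in>I. min (card (m i \<inter> Y)) c) = min g c + (\<Sum>i\<in>I'. min (card (m i \<inter> X)) c)" for c
      proof -
        have "m i \<inter> Y = m i \<inter> X" if "i \<in> I'" for i
          using disjoint_family_onD[OF less.prems(3), of i j] that j by (auto simp: Y_def I'_def)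
        then have "(\<Sum>i\<in>I'. min (card (m i \<inter> Y)) c) = (\<Sum>i\<in>I'. min (card (m i \<inter> X)) c)"
          by (intro sum.cong) auto
        moreover have "m j \<inter> Y = m j" by (auto simp: Y_def)
        ultimately show ?thesis using split[of "\<lambda>i. min (card (m i \<inter> Y)) c"] by (simp add: g_def)
      qed
      have "r + (\<Sum>i\<in>I. min (card (m i \<inter> Y)) c) \<le> F c" if c: "l \<le> c" "c \<le> \<alpha>" for c
        using XF[OF c] cF[of c] aF[of c] c rg unfolding sY F'_def by (auto split: if_splits)
      moreover have "Y \<subseteq> D" using X(1) less.prems(4)[OF j] by (auto simp: Y_def D'_def)
      ultimately show ?thesis using cY by (intro exI[of _ Y]) auto
    qed
  qed
qed

section \<open>Capped sums and legal assignments\<close>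

definition capped_sum :: "(nat \<Rightarrow> 'd set) \<Rightarrow> nat \<Rightarrow> nat \<Rightarrow> nat" where
  "capped_sum m t c = (\<Sum>x<t. min (card (m x)) c)"

definition valid :: "nat \<Rightarrow> 'd set \<Rightarrow> nat \<Rightarrow> (nat \<Rightarrow> 'd set) \<Rightarrow> bool" where
  "valid \<alpha> D t m \<longleftrightarrow>
     disjoint_family m \<and> (\<forall>x. m x \<subseteq> D \<and> card (m x) \<le> \<alpha>) \<and> (\<forall>x\<ge>t. m x = {})"

lemma validD:
  assumes "valid \<alpha> D t m"
  shows "x \<noteq> y \<Longrightarrow> m x \<inter> m y = {}" "m x \<subseteq> D" "card (m x) \<le> \<alpha>" "t \<le> x \<Longrightarrow> m x = {}"
  using assms by (auto simp: valid_def disjoint_family_on_def)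

lemma valid_finite: "valid \<alpha> D t m \<Longrightarrow> finite D \<Longrightarrow> finite (m x)"
  by (meson finite_subset validD(2))

text \<open>One round with an arbitrary reply \<open>\<mu>\<close>, detached from any algorithm, so
  that Builder can reason about all replies at once.\<close>

definition extend :: "(nat \<Rightarrow> 'd set) \<Rightarrow> nat \<Rightarrow> 'd set \<Rightarrow> nat \<Rightarrow> 'd set" where
  "extend m t \<mu> = (\<lambda>x. if x = t then \<mu> else m x - \<mu>)"

lemma assignment_Suc: "assignment A D Ns (Suc t) = extend (assignment A D Ns t) t (A D (take (Suc t) Ns))"
  by (simp add: extend_def Let_def)

declare assignment.simps(2) [simp del]

lemma valid_extend:
  assumes "valid \<alpha> D t m" "finite D" "\<mu> \<subseteq> D" "card \<mu> \<le> \<alpha>"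
  shows "valid \<alpha> D (Suc t) (extend m t \<mu>)"
proof -
  have "card (m x - \<mu>) \<le> \<alpha>" for x
    using validD(3)[OF assms(1), of x] card_mono[OF valid_finite[OF assms(1,2)], of "m x - \<mu>" x]
    by (meson Diff_subset le_trans)
  moreover have "disjoint_family (extend m t \<mu>)"
    using validD(1)[OF assms(1)] by (fastforce simp: extend_def disjoint_family_on_def)
  ultimately show ?thesis
    using assms by (auto simp: valid_def extend_def)
qed

lemma valid_empty: "valid \<alpha> D 0 (\<lambda>x. {})"
  by (simp add: valid_def disjoint_family_on_def)

lemma scheduler_choice:
  assumes "scheduler \<alpha> A" "(D, Ns) \<in> games" "t < length Ns"
  shows "A D (take (Suc t) Ns) \<subseteq> Ns ! t" "card (A D (take (Suc t) Ns)) \<le> \<alpha>" "Ns ! t \<subseteq> D" "finite D"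
proof -
  have "(D, take (Suc t) Ns) \<in> games" using assms(2) by (auto simp: games_def dest: in_set_takeD)
  moreover have "take (Suc t) Ns \<noteq> []" using assms(3) by auto
  ultimately have "A D (take (Suc t) Ns) \<subseteq> last (take (Suc t) Ns) \<and> card (A D (take (Suc t) Ns)) \<le> \<alpha>"
    using assms(1) unfolding scheduler_def by blast
  then show "A D (take (Suc t) Ns) \<subseteq> Ns ! t" "card (A D (take (Suc t) Ns)) \<le> \<alpha>"
    using assms(3) by (auto simp: take_Suc_conv_app_nth)
  show "Ns ! t \<subseteq> D" "finite D" using assms(2,3) by (auto simp: games_def)
qed

lemma valid_assignment:
  assumes "scheduler \<alpha> A" "(D, Ns) \<in> games" "t \<le> length Ns"
  shows "valid \<alpha> D t (assignment A D Ns t)"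
  using assms(3)
proof (induction t)
  case 0
  then show ?case by (simp add: valid_empty)
next
  case (Suc t)
  then show ?case
    using scheduler_choice[OF assms(1,2), of t] unfolding assignment_Suc
    by (intro valid_extend) auto
qed

lemma assignment_append: "t \<le> length Ns \<Longrightarrow> assignment A D (Ns @ Ms) t = assignment A D Ns t"
  by (induction t) (auto simp: assignment_Suc)

lemma capped_sum_extend:
  "capped_sum (extend m t \<mu>) (Suc t) c = min (card \<mu>) c + (\<Sum>x<t. min (card (m x - \<mu>)) c)"
  by (simp add: capped_sum_def extend_def)

lemma matching_size_eq_capped_sum:
  assumes "valid \<alpha> D (length Ns) (assignment A D Ns (length Ns))" "finite D"
  shows "matching_size A D Ns = capped_sum (assignment A D Ns (length Ns)) (length Ns) 1"
proof -
  let ?m = "assignment A D Ns (length Ns)"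
  have "min (card (?m x)) 1 = (if ?m x \<noteq> {} then 1 else 0)" for x
    using valid_finite[OF assms, of x] by (cases "card (?m x)") auto
  then have "capped_sum ?m (length Ns) 1 = (\<Sum>x<length Ns. if ?m x \<noteq> {} then 1 else 0)"
    by (simp add: capped_sum_def)
  also have "\<dots> = card {u \<in> {..<length Ns}. ?m u \<noteq> {}}"
    by (subst card_eq_sum, subst sum.inter_filter[symmetric]) auto
  finally show ?thesis by (simp add: matching_size_def)
qed

section \<open>Builder's strategy against an arbitrary Scheduler\<close>

text \<open>
  \<open>W\<close> holds the current sums of capped sizes, \<open>r\<close> is the number of remaining rounds, \<open>F\<close> the planned
  final sums and \<open>Y c\<close> the planned number of remaining rounds that may add \<open>c\<close> to \<open>W c\<close>. Subtraction is
  avoided by moving \<open>c * F (Suc c)\<close> to the left.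
\<close>

definition feasible :: "nat \<Rightarrow> (nat \<Rightarrow> nat) \<Rightarrow> nat \<Rightarrow> nat \<Rightarrow> bool" where
  "feasible \<alpha> W r v \<longleftrightarrow> (\<exists>F Y. F 1 = v \<and> antimono Y \<and>
     (\<forall>c\<in>{1..\<alpha>}. W c + c * Y c \<le> F c) \<and>
     (\<forall>c\<in>{1..<\<alpha>}. r + c * F (Suc c) \<le> Suc c * F c + Y c) \<and> r \<le> F \<alpha> + Y \<alpha>)"

text \<open>Builder presents the complement of a reserve \<open>X\<close>. The same \<open>F\<close>
  then serves against every reply \<open>\<mu>\<close>, with each positive \<open>Y c\<close>
  lowered by one.\<close>

lemma feasible_step:
  assumes val: "valid \<alpha> D t m" and D: "finite D" "Suc r \<le> card D"
    and "feasible \<alpha> (capped_sum m t) (Suc r) v"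
  shows "\<exists>N \<subseteq> D. card N = Suc r \<and>
    (\<forall>\<mu> \<subseteq> N. feasible \<alpha> (capped_sum (extend m t \<mu>) (Suc t)) r v)"
proof -
  obtain F Y where F1: "F 1 = v" and Y: "antimono Y"
    and WF: "\<And>c. 1 \<le> c \<Longrightarrow> c \<le> \<alpha> \<Longrightarrow> capped_sum m t c + c * Y c \<le> F c"
    and TF: "\<And>c. 1 \<le> c \<Longrightarrow> c < \<alpha> \<Longrightarrow> Suc r + c * F (Suc c) \<le> Suc c * F c + Y c"
    and top: "Suc r \<le> F \<alpha> + Y \<alpha>"
    using assms(4) unfolding feasible_def by auto
  \<comment> \<open>From \<open>l\<close> on, \<open>Y\<close> vanishes, because it is antitone;
    below \<open>l\<close> it is positive. The alternative \<open>c = Suc \<alpha>\<close> makes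
    \<open>l\<close> exist when \<open>Y\<close> is positive up to \<open>\<alpha>\<close>.\<close>
  define l where "l = (LEAST c. 1 \<le> c \<and> (c = Suc \<alpha> \<or> Y c = 0))"
  have l: "1 \<le> l \<and> (l = Suc \<alpha> \<or> Y l = 0)"
    unfolding l_def by (rule LeastI[of _ "Suc \<alpha>"]) simp
  have Y0: "Y c = 0" if "l \<le> c" "c \<le> \<alpha>" for c
    using l antimonoD[OF Y that(1)] that by auto
  have Y1: "1 \<le> Y c" if "1 \<le> c" "c < l" for c
    using not_less_Least[of c "\<lambda>c. 1 \<le> c \<and> (c = Suc \<alpha> \<or> Y c = 0)"] that by (simp add: l_def)
  have "\<exists>X \<subseteq> D. card X = card D - Suc r \<and>
    (\<forall>c. l \<le> c \<longrightarrow> c \<le> \<alpha> \<longrightarrow> Suc r + (\<Sum>x<t. min (card (m x \<inter> X)) c) \<le> F c)"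
  proof (rule exists_reserve)
    show "disjoint_family_on m {..<t}" using val by (auto simp: valid_def disjoint_family_on_def)
    show "(\<Sum>x<t. min (card (m x)) c) \<le> F c" if "l \<le> c" "c \<le> \<alpha>" for c
      using WF[of c] that l by (simp add: capped_sum_def)
    show "Suc r + c * F (Suc c) \<le> Suc c * F c" if "l \<le> c" "c < \<alpha>" for c
      using TF[of c] Y0[of c] that l by simp
    show "Suc r \<le> F \<alpha>" if "l \<le> \<alpha>" using top Y0[of \<alpha>] that by simp
  qed (use D validD[OF val] in auto)
  then obtain X where X: "X \<subseteq> D" "card X = card D - Suc r"
    and XF: "\<And>c. l \<le> c \<Longrightarrow> c \<le> \<alpha> \<Longrightarrow> Suc r + (\<Sum>x<t. min (card (m x \<inter> X)) c) \<le> F c"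
    by blast
  define N where "N = D - X"
  have N: "N \<subseteq> D" "card N = Suc r" "finite N"
    unfolding N_def using X D by (auto simp: card_Diff_subset finite_subset)
  have "feasible \<alpha> (capped_sum (extend m t \<mu>) (Suc t)) r v" if \<mu>: "\<mu> \<subseteq> N" for \<mu>
    unfolding feasible_def
  proof (rule exI[of _ F], rule exI[of _ "\<lambda>c. Y c - 1"], intro conjI ballI)
    show "F 1 = v" by fact
    show "antimono (\<lambda>c. Y c - 1)" using Y by (auto simp: antimono_def intro: diff_le_mono)
    \<comment> \<open>In this inequality and the next, the drop from \<open>Suc r\<close> to
      \<open>r\<close> pays for lowering \<open>Y\<close>.\<close>
    show "r \<le> F \<alpha> + (Y \<alpha> - 1)" using top by linarith
    show "r + c * F (Suc c) \<le> Suc c * F c + (Y c - 1)" if "c \<in> {1..<\<alpha>}" for c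
      using TF[of c] that by auto
    show "capped_sum (extend m t \<mu>) (Suc t) c + c * (Y c - 1) \<le> F c" if c: "c \<in> {1..\<alpha>}" for c
    proof (cases "c < l")
      case True
      have "(\<Sum>x<t. min (card (m x - \<mu>)) c) \<le> capped_sum m t c"
        unfolding capped_sum_def using valid_finite[OF val D(1)]
        by (intro sum_mono min.mono card_mono) auto
      then have "capped_sum (extend m t \<mu>) (Suc t) c \<le> capped_sum m t c + c"
        unfolding capped_sum_extend by simp
      moreover have "c * Y c = c + c * (Y c - 1)" using Y1[of c] True c by (cases "Y c") auto
      ultimately show ?thesis using WF[of c] c by simp
    next
      case False
      have fin: "finite (m x)" for x using valid_finite[OF val D(1)] .
      \<comment> \<open>Only the withheld part is counted with the cap. Elements of \<open>N\<close>
        are counted one by one: after any reply they are distributed over disjoint sets, hence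
        contribute at most \<open>card N = Suc r\<close> in total.\<close>
      have "min (card (m x - \<mu>)) c \<le> card (m x \<inter> N - \<mu>) + min (card (m x \<inter> X)) c" for x
      proof -
        have "m x - \<mu> \<subseteq> (m x \<inter> N - \<mu>) \<union> (m x \<inter> X)" using validD(2)[OF val, of x] by (auto simp: N_def)
        then have "card (m x - \<mu>) \<le> card (m x \<inter> N - \<mu>) + card (m x \<inter> X)"
          using fin by (meson card_Un_le card_mono finite_Diff finite_Int finite_UnI le_trans)
        then show ?thesis by linarith
      qed
      then have "(\<Sum>x<t. min (card (m x - \<mu>)) c)
          \<le> (\<Sum>x<t. card (m x \<inter> N - \<mu>)) + (\<Sum>x<t. min (card (m x \<inter> X)) c)"
        unfolding sum.distrib[symmetric] by (intro sum_mono)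
      moreover have "(\<Sum>x<t. card (m x \<inter> N - \<mu>)) + card \<mu> \<le> card N"
      proof -
        have "(\<Sum>x<t. card (m x \<inter> N - \<mu>)) = card (\<Union>x<t. m x \<inter> N - \<mu>)"
          using val fin by (intro card_UN_disjoint'[symmetric]) (auto simp: valid_def disjoint_family_on_def)
        also have "\<dots> + card \<mu> = card ((\<Union>x<t. m x \<inter> N - \<mu>) \<union> \<mu>)"
          using fin \<mu> N(3) by (intro card_Un_disjoint[symmetric]) (auto intro: finite_subset)
        also have "\<dots> \<le> card N" using \<mu> N(3) by (intro card_mono) auto
        finally show ?thesis .
      qed
      ultimately have "capped_sum (extend m t \<mu>) (Suc t) c \<le> F c"
        unfolding capped_sum_extend using XF[of c] False c N(2)
          min.cobounded1[of "card \<mu>" c] by simp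
      then show ?thesis using Y0[of c] False c by simp
    qed
  qed
  with N show ?thesis by blast
qed

lemma game_size_eqI:
  assumes "\<And>t. t < n \<Longrightarrow> card (Ns ! t) = n - t" "length Ns = n"
  shows "game_size Ns = n"
proof -
  have "\<exists>g. inj_on g {n - k..<n} \<and> (\<forall>i\<in>{n - k..<n}. g i \<in> Ns ! i)" if "k \<le> n" for k
    using that
  proof (induction k)
    case 0
    then show ?case by simp
  next
    case (Suc k)
    then obtain g where g: "inj_on g {n - k..<n}" "\<forall>i\<in>{n - k..<n}. g i \<in> Ns ! i" by auto
    \<comment> \<open>The \<open>k\<close> later rounds occupy \<open>k\<close> representatives,
      while round \<open>j\<close> offers \<open>k + 1\<close> elements.\<close>
    define j where "j = n - Suc k"
    have "card (g ` {n - k..<n}) = k" using g(1) Suc.prems by (simp add: card_image)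
    moreover have "card (Ns ! j) = Suc k" using assms(1)[of j] Suc.prems by (simp add: j_def)
    ultimately have "\<not> Ns ! j \<subseteq> g ` {n - k..<n}"
      by (metis Suc_n_not_le_n card_mono finite_atLeastLessThan finite_imageI)
    then obtain d where d: "d \<in> Ns ! j" "d \<notin> g ` {n - k..<n}" by auto
    have I: "{n - Suc k..<n} = insert j {n - k..<n}" using Suc.prems by (auto simp: j_def)
    have j: "j \<notin> {n - k..<n}" using Suc.prems by (simp add: j_def)
    have "inj_on (g(j := d)) {n - Suc k..<n}"
      unfolding I using g(1) d(2) j by (auto simp: inj_on_def)
    moreover have "\<forall>i\<in>{n - Suc k..<n}. (g(j := d)) i \<in> Ns ! i" unfolding I using g(2) d(1) j by auto
    ultimately show ?case by blast
  qed
  from this[of n] obtain g where g: "inj_on g {..<n}" "\<forall>i<n. g i \<in> Ns ! i"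
    by (auto simp: atLeast0LessThan)
  let ?M = "(\<lambda>i. (i, g i)) ` {..<n}"
  have "is_matching Ns ?M" unfolding is_matching_def edges_def using g assms(2) by (auto simp: inj_on_def)
  moreover have "card ?M = n" by (subst card_image) (auto simp: inj_on_def)
  moreover have "card M \<le> n" if "is_matching Ns M" for M
  proof -
    have "fst ` M \<subseteq> {..<n}" using that assms(2) by (auto simp: is_matching_def edges_def)
    then have "card (fst ` M) \<le> n" using card_mono[of "{..<n}" "fst ` M"] by simp
    then show ?thesis using that by (simp add: is_matching_def card_image)
  qed
  moreover from this have "{card M | M. is_matching Ns M} \<subseteq> {..n}" by auto
  then have "finite {card M | M. is_matching Ns M}" by (rule finite_subset) simp
  moreover have "n \<in> {card M | M. is_matching Ns M}"
    using \<open>is_matching Ns ?M\<close> \<open>card ?M = n\<close> by force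
  ultimately show ?thesis
    unfolding game_size_def by (intro Max_eqI) auto
qed

text \<open>On a ground set of \<open>n\<close> elements, Builder keeps \<open>v\<close> feasible
  with \<open>n - t\<close> rounds left, choosing each neighbourhood after seeing the current
  assignment. Once no round is left, the inequality at \<open>c = 1\<close> bounds the matching by
  \<open>F 1 = v\<close>.\<close>

lemma builder_strategy:
  assumes A: "scheduler \<alpha> (A :: 'd::infinite algorithm)" and "\<alpha> > 0"
    and feas: "feasible \<alpha> (\<lambda>c. 0) n v"
  shows "\<exists>D Ns. (D, Ns) \<in> games \<and> game_size Ns = n \<and> matching_size A D Ns \<le> v"
proof -
  obtain D :: "'d set" where D: "finite D" "card D = n"
    using infinite_arbitrarily_large[OF infinite_UNIV] by blast
  have "\<exists>Ns. length Ns = t \<and> (D, Ns) \<in> games \<and> (\<forall>i<t. card (Ns ! i) = n - i) \<and>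
      feasible \<alpha> (capped_sum (assignment A D Ns t) t) (n - t) v" if "t \<le> n" for t
    using that
  proof (induction t)
    case 0
    then show ?case using D feas by (auto simp: games_def capped_sum_def)
  next
    case (Suc t)
    then obtain Ns where Ns: "length Ns = t" "(D, Ns) \<in> games" "\<forall>i<t. card (Ns ! i) = n - i"
      and f: "feasible \<alpha> (capped_sum (assignment A D Ns t) t) (Suc (n - Suc t)) v"
      by (auto simp: Suc_diff_Suc)
    obtain N where N: "N \<subseteq> D" "card N = Suc (n - Suc t)"
      and step: "\<And>\<mu>. \<mu> \<subseteq> N \<Longrightarrow>
        feasible \<alpha> (capped_sum (extend (assignment A D Ns t) t \<mu>) (Suc t)) (n - Suc t) v"
      using feasible_step[OF valid_assignment[OF A Ns(2)] D(1) _ f] Ns(1) D(2) Suc.prems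
      by (metis Suc_diff_Suc Suc_le_lessD diff_le_self order_refl)
    have game: "(D, Ns @ [N]) \<in> games" using Ns(2) N(1) by (auto simp: games_def)
    have "A D (Ns @ [N]) \<subseteq> N"
      using scheduler_choice(1)[OF A game, of t] Ns(1) by (simp add: nth_append)
    then have "feasible \<alpha> (capped_sum (assignment A D (Ns @ [N]) (Suc t)) (Suc t)) (n - Suc t) v"
      unfolding assignment_Suc using step Ns(1) by (simp add: assignment_append)
    moreover have "\<forall>i<Suc t. card ((Ns @ [N]) ! i) = n - i"
      using Ns N(2) Suc.prems by (auto simp: nth_append less_Suc_eq)
    ultimately show ?case using game Ns(1) by (intro exI[of _ "Ns @ [N]"]) auto
  qed
  from this[of n] obtain Ns where Ns: "length Ns = n" "(D, Ns) \<in> games" "\<forall>i<n. card (Ns ! i) = n - i"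
      and f: "feasible \<alpha> (capped_sum (assignment A D Ns n) n) 0 v" by auto
  have "capped_sum (assignment A D Ns n) n 1 \<le> v"
  proof -
    obtain F Y where F: "F 1 = v"
      "\<And>c. c \<in> {1..\<alpha>} \<Longrightarrow> capped_sum (assignment A D Ns n) n c + c * Y c \<le> F c"
      using f unfolding feasible_def by blast
    show ?thesis using F(2)[of 1] F(1) \<open>\<alpha> > 0\<close> by simp
  qed
  then have "matching_size A D Ns \<le> v"
    using matching_size_eq_capped_sum valid_assignment[OF A Ns(2)] D(1) Ns(1) by (metis le_refl)
  moreover have "game_size Ns = n" using Ns by (intro game_size_eqI) auto
  ultimately show ?thesis using Ns(2) by blast
qed

section \<open>A single round of \<open>\<alpha>\<close>-Balanced\<close>

text \<open>
  The last clause on donors says that the maximal donor size never increases during a round; this is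
  what keeps every shrunk set at least as large as \<open>m(u)\<close>.
\<close>

definition round_inv ::
    "nat \<Rightarrow> nat \<Rightarrow> 'd set \<Rightarrow> (nat \<Rightarrow> 'd set) \<Rightarrow> 'd set \<Rightarrow> (nat \<Rightarrow> 'd set) \<Rightarrow> bool" where
  "round_inv \<alpha> u N m S k \<longleftrightarrow>
     k = extend m u (k u) \<and> S \<subseteq> k u \<and> k u \<subseteq> N \<and> k u \<subseteq> S \<union> (\<Union>x. m x) \<and> card (k u) \<le> \<alpha> \<and>
     (\<forall>x. x \<noteq> u \<longrightarrow> k x \<noteq> m x \<longrightarrow> card (k u) \<le> card (k x) \<and>
        (\<forall>e. donor k u N e \<longrightarrow> card (k e) \<le> Suc (card (k x)))) \<and>
     (\<forall>c. capped_sum m u c \<le> capped_sum k (Suc u) c)"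

lemma round_invD:
  assumes "round_inv \<alpha> u N m S k"
  shows "k = extend m u (k u)" "S \<subseteq> k u" "k u \<subseteq> N" "k u \<subseteq> S \<union> (\<Union>x. m x)" "card (k u) \<le> \<alpha>"
    "x \<noteq> u \<Longrightarrow> k x \<noteq> m x \<Longrightarrow> card (k u) \<le> card (k x)"
    "x \<noteq> u \<Longrightarrow> k x \<noteq> m x \<Longrightarrow> donor k u N e \<Longrightarrow> card (k e) \<le> Suc (card (k x))"
    "capped_sum m u c \<le> capped_sum k (Suc u) c"
    "x \<noteq> u \<Longrightarrow> k x = m x - k u"
proof -
  show *: "k = extend m u (k u)" using assms by (simp add: round_inv_def)
  show "x \<noteq> u \<Longrightarrow> k x = m x - k u" using fun_cong[OF *, of x] by (simp add: extend_def)
qed (use assms in \<open>auto simp: round_inv_def\<close>)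

text \<open>Strongly available elements lie in no set, so taking \<open>S\<close> shrinks nothing
  and the clauses on shrunk sets hold vacuously.\<close>

lemma round_inv_start:
  assumes val: "valid \<alpha> D u m" and fin: "finite D"
    and S: "S \<subseteq> {d. strongly_available (m(u := {})) u N d}" "card S \<le> \<alpha>"
  shows "round_inv \<alpha> u N m S (m(u := S))"
proof -
  have S_new: "m x \<inter> S = {}" for x
  proof (cases "x \<le> u")
    case True
    then show ?thesis using S(1) validD(4)[OF val, of u] by (auto simp: strongly_available_def split: if_splits)
  next
    case False
    then show ?thesis using validD(4)[OF val, of x] by simp
  qed
  have "extend m u S = m(u := S)" using S_new by (auto simp: extend_def fun_eq_iff)
  moreover have "S \<subseteq> N" using S(1) by (auto simp: strongly_available_def available_def)
  moreover have "capped_sum m u c \<le> capped_sum (m(u := S)) (Suc u) c" for c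
    by (simp add: capped_sum_def)
  ultimately show ?thesis using S(2) unfolding round_inv_def by simp
qed

text \<open>A donor has at least two elements more than \<open>k u\<close>, so after giving one away
  it is still as large as the enlarged \<open>k' u\<close>. Sets shrunk earlier are smaller than the
  present donor by at most one, hence they are large enough too.\<close>

lemma round_inv_move:
  assumes val: "valid \<alpha> D u m" and fin: "finite D" "finite N"
    and inv: "round_inv \<alpha> u N m S k" and "move u N k k'"
  shows "round_inv \<alpha> u N m S k'" "card (k' u) = Suc (card (k u))"
proof -
  obtain e d where e: "donor k u N e" and emax: "\<And>e'. donor k u N e' \<Longrightarrow> card (k e') \<le> card (k e)"
    and d: "d \<in> k e" "available k u N d" and k': "k' = k(e := k e - {d}, u := insert d (k u))"
    using assms(5) unfolding move_def by blast
  have size: "card (k u) + 2 \<le> card (k e)" and "e \<le> u" using e by (auto simp: donor_def ready_def)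
  then have eu: "e \<noteq> u" "e < u" by (auto simp: le_less)
  have rest: "k x = m x - k u" if "x \<noteq> u" for x using round_invD(9)[OF inv that] .
  have fin_m: "finite (m x)" for x using valid_finite[OF val fin(1)] .
  have fin_k: "finite (k x)" for x
    using rest[of x] fin_m round_invD(3)[OF inv] fin(2) by (cases "x = u") (auto intro: finite_subset)
  have d_u: "d \<notin> k u" and d_m: "d \<in> m e" using d(1) rest[OF eu(1)] by auto
  have d_other: "d \<notin> m x" if "x \<noteq> e" for x using validD(1)[OF val that] d_m by auto
  have k'u: "k' u = insert d (k u)" and k'e: "k' e = k e - {d}" using eu by (auto simp: k')
  show cu: "card (k' u) = Suc (card (k u))" using d_u fin_k by (simp add: k'u)
  have ce: "card (k' e) = card (k e) - 1" using d(1) fin_k by (simp add: k'e)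
  have k'_other: "k' x = k x" if "x \<noteq> u" "x \<noteq> e" for x using that by (simp add: k')
  have e_\<alpha>: "card (k e) \<le> \<alpha>"
    using card_mono[OF fin_m[of e], of "k e"] rest[OF eu(1)] validD(3)[OF val, of e] by simp
  have ext: "k' = extend m u (k' u)"
  proof
    fix x
    show "k' x = extend m u (k' u) x"
      using rest[of x] d_other[of x] eu by (auto simp: k' extend_def)
  qed
  have changed: "card (k e) \<le> Suc (card (k' x))" if "x \<noteq> u" "k' x \<noteq> m x" for x
    using round_invD(7)[OF inv that(1) _ e] that ce size k'_other[OF that(1)] by (cases "x = e") auto
  \<comment> \<open>Such an \<open>e'\<close> was a donor before the move, so the maximality of
    \<open>e\<close> applies. No element became available: a singleton before the move is not
    \<open>k e\<close>, which has at least two elements, so it is still there. The size required of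
    a donor has only grown.\<close>
  have donor': "card (k' e') \<le> card (k e)" if don: "donor k' u N e'" for e'
  proof -
    have size': "card (k' u) + 2 \<le> card (k' e')" "e' \<le> u" using don by (auto simp: donor_def ready_def)
    then have e'u: "e' \<noteq> u" by auto
    obtain d' where d': "d' \<in> k' e'" "available k' u N d'"
      using don unfolding donor_def ready_def by blast
    have sub: "k' e' \<subseteq> k e'" using e'u by (auto simp: k')
    then have le: "card (k' e') \<le> card (k e')" by (simp add: card_mono fin_k)
    have "k x \<noteq> {d'}" if "x < u" for x
      using d'(2) that size k'_other[of x] by (cases "x = e") (auto simp: available_def)
    then have "available k u N d'" using d'(2) by (auto simp: available_def)
    then have "donor k u N e'"
      using sub d'(1) size' le cu by (auto simp: donor_def ready_def)
    then show ?thesis using emax le by (meson le_trans)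
  qed
  have "capped_sum k (Suc u) c \<le> capped_sum k' (Suc u) c" for c
  proof -
    have split: "(\<Sum>x<Suc u. \<phi> x) = \<phi> u + (\<phi> e + (\<Sum>x\<in>{..<u} - {e}. \<phi> x))" for \<phi> :: "nat \<Rightarrow> nat"
      using eu by (simp add: sum.remove[of "{..<u}" e])
    have "(\<Sum>x\<in>{..<u} - {e}. min (card (k' x)) c) = (\<Sum>x\<in>{..<u} - {e}. min (card (k x)) c)"
      by (intro sum.cong) (auto simp: k'_other)
    \<comment> \<open>Concavity of \<open>min _ c\<close>: an element passes from a set to one
      smaller by at least two.\<close>
    moreover have "min (card (k u)) c + min (card (k e)) c \<le> min (card (k' u)) c + min (card (k' e)) c"
      using size by (auto simp: cu ce min_def)
    ultimately show ?thesis
      unfolding capped_sum_def split by simp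
  qed
  then have "capped_sum m u c \<le> capped_sum k' (Suc u) c" for c
    using round_invD(8)[OF inv] le_trans by blast
  moreover have "card (k' u) \<le> \<alpha>" using cu size e_\<alpha> by linarith
  moreover have "k' u \<subseteq> S \<union> (\<Union>x. m x)" "S \<subseteq> k' u" "k' u \<subseteq> N"
    using round_invD(2,3,4)[OF inv] d_m d(2) by (auto simp: k'u available_def)
  moreover have "card (k' u) \<le> card (k' x)" if "x \<noteq> u" "k' x \<noteq> m x" for x
    using changed[OF that] size cu by linarith
  ultimately show "round_inv \<alpha> u N m S k'"
    unfolding round_inv_def using ext changed donor' le_trans by blast
qed

lemma round_inv_moves:
  assumes "valid \<alpha> D u m" "finite D" "finite N" "round_inv \<alpha> u N m S k" "(move u N)\<^sup>*\<^sup>* k k'"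
  shows "round_inv \<alpha> u N m S k'"
  using assms(5,4) by (induction rule: rtranclp_induct) (auto intro: round_inv_move[OF assms(1-3)])

lemma move_exists:
  assumes "donor k u N e"
  shows "\<exists>k'. move u N k k'"
proof -
  have "finite {e. donor k u N e}"
    by (rule finite_subset[of _ "{..u}"]) (auto simp: donor_def ready_def)
  then obtain e where e: "donor k u N e" "\<And>e'. donor k u N e' \<Longrightarrow> card (k e') \<le> card (k e)"
    using assms finite_has_largest[of "{e. donor k u N e}" "\<lambda>e. card (k e)"] by blast
  then obtain d where "d \<in> k e" "available k u N d" by (auto simp: donor_def ready_def)
  with e show ?thesis unfolding move_def by blast
qed

text \<open>Each move adds one element to \<open>k u\<close>, which never exceeds
  \<open>\<alpha>\<close>.\<close>

lemma moves_terminate: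
  assumes "valid \<alpha> D u m" "finite D" "finite N" "round_inv \<alpha> u N m S k"
  shows "\<exists>k'. (move u N)\<^sup>*\<^sup>* k k' \<and> (\<nexists>e. donor k' u N e)"
  using assms(4)
proof (induction "\<alpha> - card (k u)" arbitrary: k rule: less_induct)
  case less
  show ?case
  proof (cases "\<exists>e. donor k u N e")
    case True
    then obtain k1 where k1: "move u N k k1" using move_exists by blast
    note inv1 = round_inv_move[OF assms(1-3) less.prems k1]
    have "\<alpha> - card (k1 u) < \<alpha> - card (k u)"
      using inv1(2) round_invD(5)[OF inv1(1)] by linarith
    then show ?thesis using less.hyps[OF _ inv1(1)] k1 by (meson converse_rtranclp_into_rtranclp)
  qed blast
qed

lemma balanced_round_exists:
  assumes val: "valid \<alpha> D u m" and fin: "finite D" and N: "N \<subseteq> D"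
  shows "\<exists>m'. balanced_round \<alpha> u N m m'"
proof -
  let ?SA = "{d. strongly_available (m(u := {})) u N d}"
  obtain S where S: "S \<subseteq> ?SA" "card S = min \<alpha> (card ?SA)"
    by (meson min.cobounded2 obtain_subset_with_card_n)
  have mu: "m(u := {}, u := S) = m(u := S)" by simp
  have "round_inv \<alpha> u N m S (m(u := S))" using round_inv_start[OF val fin S(1)] S(2) by simp
  then obtain m' where "(move u N)\<^sup>*\<^sup>* (m(u := S)) m'" "\<nexists>e. donor m' u N e"
    using moves_terminate[OF val fin finite_subset[OF N fin]] by blast
  then show ?thesis
    unfolding balanced_round_def Let_def mu using S by (intro exI[of _ m'] exI[of _ S]) simp
qed

lemma balanced_roundD:
  assumes val: "valid \<alpha> D u m" and fin: "finite D" and N: "N \<subseteq> D" and round: "balanced_round \<alpha> u N m m'"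
  shows "m' = extend m u (m' u)" "m' u \<subseteq> N" "card (m' u) \<le> \<alpha>"
    "x \<noteq> u \<Longrightarrow> m' x \<noteq> m x \<Longrightarrow> card (m' u) \<le> card (m' x)"
    "capped_sum m u c \<le> capped_sum m' (Suc u) c"
    "d \<in> N \<Longrightarrow> card (m' u) < \<alpha> \<Longrightarrow> \<exists>x\<le>u. d \<in> m' x \<and> card (m' x) \<le> Suc (card (m' u))"
    "valid \<alpha> D (Suc u) m'"
proof -
  let ?SA = "{d. strongly_available (m(u := {})) u N d}"
  obtain S where S: "S \<subseteq> ?SA" "card S = min \<alpha> (card ?SA)"
    and moves: "(move u N)\<^sup>*\<^sup>* (m(u := S)) m'" and final: "\<nexists>e. donor m' u N e"
    using round unfolding balanced_round_def Let_def by auto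
  have finN: "finite N" using N fin by (rule finite_subset)
  have "round_inv \<alpha> u N m S (m(u := S))" using round_inv_start[OF val fin S(1)] S(2) by simp
  from round_inv_moves[OF val fin finN this moves] have inv: "round_inv \<alpha> u N m S m'" .
  show ext: "m' = extend m u (m' u)" "m' u \<subseteq> N" "card (m' u) \<le> \<alpha>"
    "x \<noteq> u \<Longrightarrow> m' x \<noteq> m x \<Longrightarrow> card (m' u) \<le> card (m' x)"
    "capped_sum m u c \<le> capped_sum m' (Suc u) c"
    using round_invD[OF inv] by blast+
  show val': "valid \<alpha> D (Suc u) m'"
    by (subst ext(1)) (use valid_extend[OF val fin] ext(2,3) N in auto)
  show "\<exists>x\<le>u. d \<in> m' x \<and> card (m' x) \<le> Suc (card (m' u))" if d: "d \<in> N" "card (m' u) < \<alpha>"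
  proof (cases "available m' u N d")
    case False
    then obtain x where "x < u" "m' x = {d}" using d(1) by (auto simp: available_def)
    then show ?thesis by (intro exI[of _ x]) auto
  next
    case True
    show ?thesis
    proof (cases "\<exists>x\<le>u. d \<in> m' x")
      case True
      then obtain x where x: "x \<le> u" "d \<in> m' x" by blast
      then have "ready m' u N x" using \<open>available m' u N d\<close> by (auto simp: ready_def)
      then have "card (m' x) \<le> Suc (card (m' u))" using final by (force simp: donor_def)
      with x show ?thesis by blast
    next
      case False
      then have d': "d \<notin> m' x" for x using validD(4)[OF val', of x] by (cases "x \<le> u") auto
      have dm: "d \<notin> m x" for x
        using round_invD(9)[OF inv, of x] d'[of x] d'[of u] validD(4)[OF val, of u] by (cases "x = u") auto
      then have "d \<in> ?SA" using d(1) by (auto simp: strongly_available_def available_def)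
      moreover have "d \<notin> S" using round_invD(2)[OF inv] d' by blast
      moreover have "finite ?SA"
        by (rule finite_subset[OF _ finN]) (auto simp: strongly_available_def available_def)
      ultimately have "card S < card ?SA" using S(1) by (intro psubset_card_mono) auto
      then have "card S = \<alpha>" using S(2) by linarith
      moreover have "card S \<le> card (m' u)"
        using round_invD(2)[OF inv] ext(2) finN by (meson card_mono finite_subset)
      ultimately show ?thesis using d(2) by simp
    qed
  qed
qed

section \<open>Capped sums and small sets under a round of \<open>\<alpha>\<close>-Balanced\<close>

lemma balanced_round_large:
  assumes val: "valid \<alpha> D u m" and fin: "finite D" and N: "N \<subseteq> D" and round: "balanced_round \<alpha> u N m m'"
    and "c \<le> card (m' u)"
  shows "capped_sum m' (Suc u) c = capped_sum m u c + c"
proof -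
  note round' = balanced_roundD[OF val fin N round]
  have "min (card (m' x)) c = min (card (m x)) c" if "x < u" for x
  proof (cases "m' x = m x")
    case False
    then have "c \<le> card (m' x)" using round'(4)[of x] that assms(5) by auto
    moreover have "m' x \<subseteq> m x" using fun_cong[OF round'(1), of x] that by (auto simp: extend_def)
    then have "card (m' x) \<le> card (m x)" using valid_finite[OF val fin] by (simp add: card_mono)
    ultimately show ?thesis by simp
  qed simp
  then show ?thesis using assms(5) by (simp add: capped_sum_def min_absorb2)
qed

definition small :: "(nat \<Rightarrow> 'd set) \<Rightarrow> nat \<Rightarrow> nat \<Rightarrow> 'd set" where
  "small m t c = (\<Union>x\<in>{x. x < t \<and> card (m x) \<le> c}. m x)"

text \<open>An element leaving a set of size at most \<open>c\<close> goes to \<open>m' u\<close>,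
  which is no larger than what remains of that set.\<close>

lemma small_mono:
  assumes val: "valid \<alpha> D u m" and fin: "finite D" and N: "N \<subseteq> D" and round: "balanced_round \<alpha> u N m m'"
  shows "small m u c \<subseteq> small m' (Suc u) c"
proof
  fix d
  assume "d \<in> small m u c"
  then obtain x where x: "x < u" "card (m x) \<le> c" "d \<in> m x" by (auto simp: small_def)
  note round' = balanced_roundD[OF val fin N round]
  have m'x: "m' x = m x - m' u" using fun_cong[OF round'(1), of x] x(1) by (auto simp: extend_def)
  then have le: "card (m' x) \<le> card (m x)" using valid_finite[OF val fin] by (simp add: card_mono)
  show "d \<in> small m' (Suc u) c"
  proof (cases "d \<in> m' u")
    case True
    then have "m' x \<noteq> m x" using m'x x(3) by auto
    then have "card (m' u) \<le> c" using round'(4)[of x] x le by force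
    then show ?thesis using True unfolding small_def by blast
  next
    case False
    then show ?thesis using m'x x le unfolding small_def by (intro UN_I[of x]) auto
  qed
qed

text \<open>The identity holds set by set: a set of size \<open>s \<le> c\<close> adds
  \<open>(c + 1) * s\<close> to both sides, a larger one \<open>c * (c + 1)\<close>. At
  \<open>\<alpha>\<close> every set is small.\<close>

lemma card_small:
  assumes "valid \<alpha> D t m" "finite D"
  shows "card (small m t c) + c * capped_sum m t (Suc c) = Suc c * capped_sum m t c"
    and "card (small m t \<alpha>) = capped_sum m t \<alpha>"
proof -
  have *: "card (small m t c) = (\<Sum>x<t. if card (m x) \<le> c then card (m x) else 0)" for c
  proof -
    have "card (small m t c) = (\<Sum>x\<in>{x. x < t \<and> card (m x) \<le> c}. card (m x))"
      unfolding small_def using assms valid_finite[OF assms]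
      by (intro card_UN_disjoint') (auto simp: valid_def disjoint_family_on_def)
    also have "{x. x < t \<and> card (m x) \<le> c} = {x \<in> {..<t}. card (m x) \<le> c}" by auto
    finally show ?thesis by (simp only: sum.inter_filter finite_lessThan)
  qed
  show "card (small m t c) + c * capped_sum m t (Suc c) = Suc c * capped_sum m t c"
    unfolding * capped_sum_def sum_distrib_left sum.distrib[symmetric]
    by (intro sum.cong) (auto simp: min_def le_Suc_eq)
  show "card (small m t \<alpha>) = capped_sum m t \<alpha>"
    unfolding * capped_sum_def using validD(3)[OF assms(1)] by (intro sum.cong) auto
qed

section \<open>\<open>\<alpha>\<close>-Balanced as a Scheduler algorithm\<close>

lemma balanced_at:
  assumes "balanced \<alpha> A" "(D, Ns) \<in> games" "t < length Ns"
  shows "balanced_round \<alpha> t (Ns ! t) (assignment A D Ns t) (assignment A D Ns (Suc t))"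
    "Ns ! t \<subseteq> D" "finite D"
  using assms unfolding balanced_def games_def by auto

lemma balanced_valid:
  assumes "balanced \<alpha> A" "(D, Ns) \<in> games" "t \<le> length Ns"
  shows "valid \<alpha> D t (assignment A D Ns t)"
  using assms(3)
proof (induction t)
  case 0
  then show ?case by (simp add: valid_empty)
next
  case (Suc t)
  then show ?case using balanced_at[OF assms(1,2), of t] by (auto intro: balanced_roundD(7))
qed

text \<open>\<open>balanced\<close> speaks only of assignments, but right after a round the entry of
  the current vertex is the algorithm's choice itself.\<close>

lemma balanced_scheduler:
  assumes "balanced \<alpha> A"
  shows "scheduler \<alpha> A"
  unfolding scheduler_def
proof (clarify)
  fix D and Ns :: "'a set list"
  assume game: "(D, Ns) \<in> games" and "Ns \<noteq> []"
  define t where "t = length Ns - 1"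
  have t: "t < length Ns" "Suc t = length Ns" using \<open>Ns \<noteq> []\<close> by (auto simp: t_def)
  have "valid \<alpha> D t (assignment A D Ns t)" using balanced_valid[OF assms game] t by simp
  note rd = balanced_roundD(2,3)[OF this balanced_at(3,2,1)[OF assms game t(1)]]
  have "assignment A D Ns (Suc t) t = A D Ns"
    unfolding assignment_Suc by (simp add: extend_def t(2))
  then show "A D Ns \<subseteq> last Ns \<and> card (A D Ns) \<le> \<alpha>"
    using rd \<open>Ns \<noteq> []\<close> by (simp add: last_conv_nth t_def)
qed

text \<open>The list is the history with the newest round first, so the length of the tail is the
  number of the current vertex.\<close>

primrec balanced_run :: "nat \<Rightarrow> 'd set list \<Rightarrow> nat \<Rightarrow> 'd set" where
  "balanced_run \<alpha> [] = (\<lambda>x. {})"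
| "balanced_run \<alpha> (N # Ns) = (SOME m'. balanced_round \<alpha> (length Ns) N (balanced_run \<alpha> Ns) m')"

text \<open>The algorithm reads its choice off \<open>balanced_run\<close>. Induction on the rounds
  shows that its assignments agree with the run and stay valid, and validity guarantees that
  \<open>SOME\<close> picks a genuine round.\<close>

lemma balanced_exists: "\<exists>A :: 'd algorithm. balanced \<alpha> A"
proof -
  define A :: "'d algorithm" where "A D Ns = balanced_run \<alpha> (rev Ns) (length Ns - 1)" for D Ns
  have "balanced_round \<alpha> t (Ns ! t) (assignment A D Ns t) (assignment A D Ns (Suc t))"
    if game: "(D, Ns) \<in> games" and "t < length Ns" for D Ns t
  proof -
    have D: "finite D" using game by (simp add: games_def)
    have step: "balanced_round \<alpha> t (Ns ! t) (assignment A D Ns t) (assignment A D Ns (Suc t)) \<and>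
        assignment A D Ns (Suc t) = balanced_run \<alpha> (rev (take (Suc t) Ns))"
      if t: "t < length Ns" and run: "assignment A D Ns t = balanced_run \<alpha> (rev (take t Ns))"
        and val: "valid \<alpha> D t (assignment A D Ns t)" for t
    proof -
      let ?m = "assignment A D Ns t" and ?m' = "balanced_run \<alpha> (rev (take (Suc t) Ns))"
      have N: "Ns ! t \<subseteq> D" using game t by (auto simp: games_def)
      have "?m' = (SOME m'. balanced_round \<alpha> t (Ns ! t) ?m m')"
        using t run by (simp add: take_Suc_conv_app_nth)
      then have rd: "balanced_round \<alpha> t (Ns ! t) ?m ?m'"
        using someI_ex[OF balanced_round_exists[OF val D N]] by simp
      have "A D (take (Suc t) Ns) = ?m' t" unfolding A_def using t by (simp add: min_absorb2)
      then have "assignment A D Ns (Suc t) = ?m'"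
        unfolding assignment_Suc using balanced_roundD(1)[OF val D N rd] by simp
      with rd show ?thesis by simp
    qed
    have "assignment A D Ns t = balanced_run \<alpha> (rev (take t Ns)) \<and> valid \<alpha> D t (assignment A D Ns t)"
      if "t \<le> length Ns" for t
      using that
    proof (induction t)
      case 0
      then show ?case by (simp add: valid_empty)
    next
      case (Suc t)
      then have t: "t < length Ns" and val: "valid \<alpha> D t (assignment A D Ns t)" by auto
      have N: "Ns ! t \<subseteq> D" using game t by (auto simp: games_def)
      show ?case using step[OF t _ val] Suc balanced_roundD(7)[OF val D N] by auto
    qed
    then show ?thesis using step[of t] \<open>t < length Ns\<close> less_imp_le by blast
  qed
  then have "balanced \<alpha> A" unfolding balanced_def by blast
  then show ?thesis by blast
qed

section \<open>The inequalities for games against \<open>\<alpha>\<close>-Balanced\<close>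

lemma finite_matchings: "finite {card M | M. is_matching Ns M}"
proof (rule finite_subset)
  show "{card M | M. is_matching Ns M} \<subseteq> {..length Ns}"
  proof
    fix k
    assume "k \<in> {card M | M. is_matching Ns M}"
    then obtain M where "k = card M" "is_matching Ns M" by blast
    moreover from this have "fst ` M \<subseteq> {..<length Ns}" "card (fst ` M) = card M"
      by (auto simp: is_matching_def edges_def card_image)
    ultimately show "k \<in> {..length Ns}"
      using card_mono[of "{..<length Ns}" "fst ` M"] by simp
  qed
qed simp

lemma game_size_attained: "\<exists>M. is_matching Ns M \<and> card M = game_size Ns"
proof -
  have "is_matching Ns {}" by (simp add: is_matching_def)
  then have "game_size Ns \<in> {card M | M. is_matching Ns M}"
    unfolding game_size_def by (intro Max_in finite_matchings) blast
  then show ?thesis by auto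
qed

text \<open>Builder's plan is read off the game: \<open>F\<close> from the final assignment,
  \<open>Y c\<close> from the number of rounds of level at least \<open>c\<close>. The size
  \<open>game_size Ns\<close> takes the place of \<open>r\<close>, so the plan is for a game of that
  many rounds, however many this one had.\<close>

lemma balanced_feasible:
  assumes bal: "balanced \<alpha> A" and game: "(D, Ns) \<in> games" and "\<alpha> > 0"
  shows "feasible \<alpha> (\<lambda>c. 0) (game_size Ns) (matching_size A D Ns)"
proof -
  let ?m = "assignment A D Ns"
  \<comment> \<open>The size of the current vertex's set at the end of its own round, before any
    later shrinking.\<close>
  define level where "level s = card (?m (Suc s) s)" for s
  let ?n = "length Ns"
  have D: "finite D" using game by (simp add: games_def)
  note val = balanced_valid[OF bal game]
  note at = balanced_at[OF bal game]
  have births: "c * card {s. s < t \<and> c \<le> level s} \<le> capped_sum (?m t) t c" if "t \<le> ?n" for t c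
    using that
  proof (induction t)
    case (Suc t)
    then have t: "t < ?n" and IH: "c * card {s. s < t \<and> c \<le> level s} \<le> capped_sum (?m t) t c" by auto
    note rd = val[OF less_imp_le[OF t]] at(3,2,1)[OF t]
    show ?case
    proof (cases "c \<le> level t")
      case True
      then have "{s. s < Suc t \<and> c \<le> level s} = insert t {s. s < t \<and> c \<le> level s}" by auto
      then show ?thesis using IH balanced_round_large[OF rd, of c] True by (simp add: level_def)
    next
      case False
      then have "{s. s < Suc t \<and> c \<le> level s} = {s. s < t \<and> c \<le> level s}" by (auto simp: less_Suc_eq)
      then show ?thesis using IH balanced_roundD(5)[OF rd, of c] by simp
    qed
  qed simp
  \<comment> \<open>As \<open>level s < \<alpha>\<close>, the whole neighbourhood lies in small sets
    at the end of round \<open>s\<close>; later rounds keep it there.\<close>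
  have nbrs: "Ns ! s \<subseteq> small (?m t) t c" if "t \<le> ?n" "s < t" and c: "level s < c" "c \<le> \<alpha>" for s t c
    using that(1,2)
  proof (induction t)
    case (Suc t)
    then have t: "t < ?n" by simp
    note rd = val[OF less_imp_le[OF t]] at(3,2,1)[OF t]
    show ?case
    proof (cases "s = t")
      case True
      show ?thesis
      proof
        fix d
        assume "d \<in> Ns ! s"
        then obtain x where "x \<le> t" "d \<in> ?m (Suc t) x" "card (?m (Suc t) x) \<le> Suc (level t)"
          using balanced_roundD(6)[OF rd, of d] c True by (auto simp: level_def)
        then show "d \<in> small (?m (Suc t)) (Suc t) c"
          using c(1) True unfolding small_def by (intro UN_I[of x]) auto
      qed
    next
      case False
      then show ?thesis using Suc small_mono[OF rd, of c] by auto
    qed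
  qed simp
  have fin_small: "finite (small (?m ?n) ?n c)" for c
    using valid_finite[OF val D] by (auto simp: small_def)
  obtain M where M: "is_matching Ns M" "card M = game_size Ns" using game_size_attained by blast
  \<comment> \<open>Matching edges at vertices of level at least \<open>c\<close> are counted by
    these vertices, the others by their partners in small sets.\<close>
  have cover: "game_size Ns \<le> card (small (?m ?n) ?n c) + card {s. s < ?n \<and> c \<le> level s}"
    if "c \<le> \<alpha>" for c
  proof -
    define M1 where "M1 = {e \<in> M. c \<le> level (fst e)}"
    define M2 where "M2 = {e \<in> M. \<not> c \<le> level (fst e)}"
    have "M = M1 \<union> M2" by (auto simp: M1_def M2_def)
    then have "card M \<le> card M1 + card M2" by (simp add: card_Un_le)
    moreover have "card M1 \<le> card {s. s < ?n \<and> c \<le> level s}"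
    proof (rule card_inj_on_le)
      show "inj_on fst M1" using M(1) unfolding M1_def is_matching_def by (auto intro: inj_on_subset)
      show "fst ` M1 \<subseteq> {s. s < ?n \<and> c \<le> level s}"
        using M(1) by (auto simp: M1_def is_matching_def edges_def)
    qed simp
    moreover have "card M2 \<le> card (small (?m ?n) ?n c)"
    proof (rule card_inj_on_le)
      show "inj_on snd M2" using M(1) unfolding M2_def is_matching_def by (auto intro: inj_on_subset)
      show "snd ` M2 \<subseteq> small (?m ?n) ?n c"
      proof clarify
        fix u d
        assume "(u, d) \<in> M2"
        then have "u < ?n" "d \<in> Ns ! u" "level u < c"
          using M(1) by (auto simp: M2_def is_matching_def edges_def)
        then show "snd (u, d) \<in> small (?m ?n) ?n c" using nbrs[of ?n u c] that by auto
      qed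
    qed (rule fin_small)
    ultimately show ?thesis using M(2) by linarith
  qed
  show ?thesis
    unfolding feasible_def
  proof (rule exI[of _ "capped_sum (?m ?n) ?n"], rule exI[of _ "\<lambda>c. card {s. s < ?n \<and> c \<le> level s}"],
      intro conjI ballI)
    show "capped_sum (?m ?n) ?n 1 = matching_size A D Ns"
      using matching_size_eq_capped_sum[OF val D] by simp
    show "antimono (\<lambda>c. card {s. s < ?n \<and> c \<le> level s})"
      by (intro antimonoI card_mono) auto
    show "0 + c * card {s. s < ?n \<and> c \<le> level s} \<le> capped_sum (?m ?n) ?n c" for c
      using births[of ?n c] by simp
    show "game_size Ns + c * capped_sum (?m ?n) ?n (Suc c)
        \<le> Suc c * capped_sum (?m ?n) ?n c + card {s. s < ?n \<and> c \<le> level s}" if "c \<in> {1..<\<alpha>}" for c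
      using cover[of c] that card_small(1)[OF val D, of ?n c] by simp
    show "game_size Ns \<le> capped_sum (?m ?n) ?n \<alpha> + card {s. s < ?n \<and> \<alpha> \<le> level s}"
      using cover[of \<alpha>] card_small(2)[OF val D, of ?n] by simp
  qed
qed

section \<open>Worst-case values and optimality\<close>

text \<open>Final sets are disjoint, so picking one element from each nonempty set gives a matching.
  This makes the set under \<open>Min\<close> in \<open>val_alg\<close> finite.\<close>

lemma matching_size_le:
  assumes A: "scheduler \<alpha> A" and game: "(D, Ns) \<in> games"
  shows "matching_size A D Ns \<le> game_size Ns"
proof -
  let ?m = "\<lambda>t. assignment A D Ns t"
  let ?U = "{u. u < length Ns \<and> ?m (length Ns) u \<noteq> {}}"
  have val: "valid \<alpha> D (length Ns) (?m (length Ns))" using valid_assignment[OF A game] by simp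
  have sub: "?m t x \<subseteq> Ns ! x" if "t \<le> length Ns" "x < t" for t x
    using that
  proof (induction t)
    case (Suc t)
    then show ?case
      using scheduler_choice(1)[OF A game, of t] unfolding assignment_Suc
      by (cases "x = t") (auto simp: extend_def)
  qed simp
  define g where "g u = (SOME d. d \<in> ?m (length Ns) u)" for u
  have g: "g u \<in> ?m (length Ns) u" if "u \<in> ?U" for u
    using that unfolding g_def by (auto intro: someI)
  have "inj_on g ?U"
  proof (rule inj_onI)
    fix u v assume "u \<in> ?U" "v \<in> ?U" "g u = g v"
    then show "u = v" using g[of u] g[of v] validD(1)[OF val, of u v] by auto
  qed
  moreover have "g u \<in> Ns ! u" if "u \<in> ?U" for u using g[OF that] sub[of "length Ns" u] that by auto
  ultimately have "is_matching Ns ((\<lambda>u. (u, g u)) ` ?U)"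
    unfolding is_matching_def edges_def by (auto simp: inj_on_def)
  moreover have "card ((\<lambda>u. (u, g u)) ` ?U) = matching_size A D Ns"
    unfolding matching_size_def by (intro card_image) (auto simp: inj_on_def)
  ultimately show ?thesis
    unfolding game_size_def by (intro Max_ge finite_matchings) force
qed

text \<open>Makes the set under \<open>Min\<close> in \<open>val_alg\<close> nonempty.\<close>

lemma game_exists: "\<exists>(D :: 'd::infinite set) Ns. (D, Ns) \<in> games \<and> game_size Ns = n"
proof -
  obtain D :: "'d set" where D: "finite D" "card D = n"
    using infinite_arbitrarily_large[OF infinite_UNIV] by blast
  have "\<exists>N \<subseteq> D. card N = n - t" for t using D by (metis diff_le_self obtain_subset_with_card_n)
  then obtain N where N: "\<And>t. N t \<subseteq> D" "\<And>t. card (N t) = n - t" by metis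
  have "(D, map N [0..<n]) \<in> games" using D N by (auto simp: games_def)
  moreover have "game_size (map N [0..<n]) = n" using N by (intro game_size_eqI) auto
  ultimately show ?thesis by blast
qed

lemma
  fixes A :: "'d::infinite algorithm"
  assumes "scheduler \<alpha> A"
  shows val_alg_attained: "\<exists>D Ns. (D, Ns) \<in> games \<and> game_size Ns = n \<and> matching_size A D Ns = val_alg A n"
    and val_alg_le: "(D, Ns) \<in> games \<Longrightarrow> game_size Ns = n \<Longrightarrow> val_alg A n \<le> matching_size A D Ns"
proof -
  let ?V = "{matching_size A D Ns | D Ns. (D, Ns) \<in> games \<and> game_size Ns = n}"
  have sub: "?V \<subseteq> {..n}" using matching_size_le[OF assms] by auto
  then have fin: "finite ?V" by (rule finite_subset) simp
  moreover have "?V \<noteq> {}" using game_exists[where 'd = 'd, of n] by blast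
  ultimately have "val_alg A n \<in> ?V" unfolding val_alg_def by (rule Min_in)
  then obtain D' Ns' where "(D', Ns') \<in> games" "game_size Ns' = n" "val_alg A n = matching_size A D' Ns'"
    by blast
  then show "\<exists>D Ns. (D, Ns) \<in> games \<and> game_size Ns = n \<and> matching_size A D Ns = val_alg A n"
    by metis
  show "val_alg A n \<le> matching_size A D Ns" if "(D, Ns) \<in> games" "game_size Ns = n"
    unfolding val_alg_def using fin that by (intro Min_le) blast+
qed

theorem theorem1:
  fixes \<alpha> n :: nat
  assumes "\<alpha> > 0"
  shows "(\<exists>A :: 'd::infinite algorithm. balanced \<alpha> A) \<and>
         (\<forall>A :: 'd algorithm. balanced \<alpha> A \<longrightarrow>
            scheduler \<alpha> A \<and> val_alg A n = val TYPE('d) \<alpha> n)"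
proof (intro conjI allI impI)
  show "\<exists>A :: 'd algorithm. balanced \<alpha> A" by (rule balanced_exists)
  fix A :: "'d algorithm"
  assume bal: "balanced \<alpha> A"
  then show A: "scheduler \<alpha> A" by (rule balanced_scheduler)
  obtain D :: "'d set" and Ns where game: "(D, Ns) \<in> games" "game_size Ns = n"
    and "matching_size A D Ns = val_alg A n"
    using val_alg_attained[OF A] by blast
  \<comment> \<open>A worst game for \<open>A\<close> supplies the plan that Builder follows against
    every other \<open>B\<close>.\<close>
  then have feas: "feasible \<alpha> (\<lambda>c. 0) n (val_alg A n)"
    using balanced_feasible[OF bal game(1) assms] by simp
  have opt: "val_alg B n \<le> val_alg A n" if B: "scheduler \<alpha> B" for B :: "'d algorithm"
    using builder_strategy[OF B assms feas] val_alg_le[OF B] le_trans by blast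
  \<comment> \<open>The bound \<open>opt\<close> also makes the set under \<open>Max\<close>
    finite.\<close>
  then show "val_alg A n = val TYPE('d) \<alpha> n"
    unfolding val_def using A
    by (intro Max_eqI[symmetric]) (auto intro: finite_subset[of _ "{..val_alg A n}"])
qed

end
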